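(* Let $X$ be a real Hilbert space, let $m\ge 2$ be an integer, let $T_1,\ldots,T_m\colon X\to X$ be firmly nonexpansive, let $\lambda_1,\ldots,\lambda_m\in\left]0,1\right]$ satisfy $\sum_{i=1}^m\lambda_i=1$, and set $\overline{T}:=\sum_{i=1}^m\lambda_iT_i$. Then $$\|v_{\overline{T}}\|\le\Big\|\sum_{i=1}^m\lambda_iv_{T_i}\Big\|,$$ where $v_S$ denotes the minimal displacement vector of $S$.
   Context: $X$ is a real Hilbert space with inner product $\langle\cdot,\cdot\rangle$ and induced norm $\|\cdot\|$. A map $T\colon X\to X$ is firmly nonexpansive if $\|Tx-Ty\|^2\le\langle x-y,Tx-Ty\rangle$ for all $x,y\in X$; convex combinations of firmly nonexpansive maps are firmly nonexpansive. For a firmly nonexpansive map $S\colon X\to X$, the set $\overline{\operatorname{ran}}(\operatorname{Id}-S)=\overline{\{x-Sx : x\in X\}}$ is nonempty, closed and convex, and the minimal displacement vector of $S$ is $v_S:=P_{\overline{\operatorname{ran}}(\operatorname{Id}-S)}(0)$, the projection of $0$ onto this set, i.e. its unique element of minimal norm. *)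

theory Defs
  imports "HOL-Analysis.Analysis"
begin

definition firmly_nonexpansive :: "('a::real_inner \<Rightarrow> 'a) \<Rightarrow> bool" where
  "firmly_nonexpansive T \<longleftrightarrow>
     (\<forall>x y. (norm (T x - T y))\<^sup>2 \<le> (x - y) \<bullet> (T x - T y))"

text \<open>
  The library constant \<open>closest_point\<close> requires a \<open>heine_borel\<close> type, hence finite
  dimension.  The definite description below is meaningful if there is a unique nearest point,
  in particular if \<open>C\<close> is a nonempty closed convex subset of a complete space.
\<close>

definition metric_projection :: "'a::real_inner set \<Rightarrow> 'a \<Rightarrow> 'a" where
  "metric_projection C a = (THE p. p \<in> C \<and> (\<forall>y\<in>C. dist a p \<le> dist a y))"

definition min_displacement :: "('a::real_inner \<Rightarrow> 'a) \<Rightarrow> 'a" where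
  "min_displacement S = metric_projection (closure (range (\<lambda>x. x - S x))) 0"

end

(*
  Each displacement map F_i = Id - T_i is firmly nonexpansive, hence cocoercive, and so is
  F = \<Sum>i. l_i F_i = Id - \<Sum>i. l_i T_i.  Following Brezis and Haraux, every sum
  z = \<Sum>i. l_i F_i(y_i) lies in the closure of ran F: for e > 0 the equation e x + F x = z
  has a solution x, and cocoercivity bounds e |x|^2 by a constant independent of e, so
  |z - F x| = e |x| tends to 0 with e.  Hence \<Sum>i. l_i v_i lies in the closure of ran F,
  whose element of least norm is the minimal displacement vector of \<Sum>i. l_i T_i.  Applied
  with all F_i equal, the same fact shows that the closure of ran F is convex.
*)

theory Submission
  imports Defs
begin

section \<open>Nearest points in closed convex sets\<close>

lemma midpoint_parallelogram:
  fixes a p q :: "'a::real_inner"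
  shows "(dist p q)\<^sup>2 = 2 * (dist a p)\<^sup>2 + 2 * (dist a q)\<^sup>2
           - 4 * (dist a ((1/2) *\<^sub>R p + (1/2) *\<^sub>R q))\<^sup>2"
  unfolding dist_norm power2_norm_eq_inner
  by (simp add: inner_diff_left inner_diff_right inner_add_left inner_add_right inner_commute
      algebra_simps)

text \<open>By the parallelogram law, points of \<open>C\<close> that nearly minimize the distance
  to \<open>a\<close> are close to each other. This makes a minimizing sequence Cauchy and also
  forces uniqueness.\<close>

lemma ex1_nearest_point:
  fixes C :: "'a::{real_inner, banach} set"
  assumes "convex C" "closed C" "C \<noteq> {}"
  shows "\<exists>!p. p \<in> C \<and> (\<forall>y\<in>C. dist a p \<le> dist a y)"
proof -
  define D where "D = (INF y\<in>C. (dist a y)\<^sup>2)"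
  have bdd: "bdd_below ((\<lambda>y. (dist a y)\<^sup>2) ` C)"
    by (rule bdd_belowI[of _ 0]) auto
  have D_le: "D \<le> (dist a y)\<^sup>2" if "y \<in> C" for y
    unfolding D_def using bdd that by (rule cINF_lower)
  \<comment> \<open>Convexity puts the midpoint in \<open>C\<close>, so its squared distance to
    \<open>a\<close> is at least \<open>D\<close>.\<close>
  have gap: "(dist p q)\<^sup>2 \<le> 2 * ((dist a p)\<^sup>2 - D) + 2 * ((dist a q)\<^sup>2 - D)"
    if "p \<in> C" "q \<in> C" for p q
  proof -
    have "(1/2) *\<^sub>R p + (1/2) *\<^sub>R q \<in> C"
      using assms(1) that by (intro convexD) auto
    from D_le[OF this] show ?thesis
      by (simp add: midpoint_parallelogram[of p q a])
  qed
  have "\<exists>p\<in>C. (dist a p)\<^sup>2 < D + inverse (real (Suc n))" for n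
  proof -
    have "(INF y\<in>C. (dist a y)\<^sup>2) < D + inverse (real (Suc n))"
      by (simp add: D_def)
    then show ?thesis
      using cINF_less_iff[OF assms(3) bdd] by blast
  qed
  then obtain p where pC: "\<And>n. p n \<in> C"
    and p_less: "\<And>n. (dist a (p n))\<^sup>2 < D + inverse (real (Suc n))"
    by metis
  have "Cauchy p"
  proof (rule metric_CauchyI)
    fix e :: real
    assume "e > 0"
    \<comment> \<open>In \<open>gap\<close> each of the two excesses over \<open>D\<close> counts
      twice, so a quarter of \<open>e\<^sup>2\<close> for each suffices.\<close>
    then obtain N where N: "inverse (real (Suc N)) < e\<^sup>2 / 4"
      using reals_Archimedean[of "e\<^sup>2 / 4"] by auto
    have "dist (p k) (p n) < e" if "k \<ge> N" "n \<ge> N" for k n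
    proof -
      have less: "(dist a (p j))\<^sup>2 < D + e\<^sup>2 / 4" if "j \<ge> N" for j
      proof -
        have "inverse (real (Suc j)) \<le> inverse (real (Suc N))"
          using that by simp
        then show ?thesis
          using p_less[of j] N by argo
      qed
      have "(dist (p k) (p n))\<^sup>2 < e\<^sup>2"
        using gap[OF pC pC, of k n] less[OF that(1)] less[OF that(2)] by argo
      then show ?thesis
        using \<open>e > 0\<close> by (simp add: power_less_imp_less_base)
    qed
    then show "\<exists>M. \<forall>k\<ge>M. \<forall>n\<ge>M. dist (p k) (p n) < e"
      by blast
  qed
  then obtain q where q: "p \<longlonglongrightarrow> q"
    using Cauchy_convergent_iff convergent_def by blast
  have qC: "q \<in> C"
    using assms(2) pC q closed_sequentially by blast
  have "(dist a q)\<^sup>2 \<le> D"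
  proof (rule LIMSEQ_le)
    show "(\<lambda>n. (dist a (p n))\<^sup>2) \<longlonglongrightarrow> (dist a q)\<^sup>2"
      by (intro tendsto_intros q)
    show "(\<lambda>n. D + inverse (real (Suc n))) \<longlonglongrightarrow> D"
      using tendsto_add[OF tendsto_const LIMSEQ_inverse_real_of_nat, of D] by simp
    show "\<exists>N. \<forall>n\<ge>N. (dist a (p n))\<^sup>2 \<le> D + inverse (real (Suc n))"
      using p_less less_imp_le by blast
  qed
  then have q_min: "dist a q \<le> dist a y" if "y \<in> C" for y
    using order_trans[OF _ D_le[OF that]] by (auto intro: power2_le_imp_le)
  show ?thesis
  proof (rule ex1I[of _ q])
    show "q \<in> C \<and> (\<forall>y\<in>C. dist a q \<le> dist a y)"
      using qC q_min by blast
    fix r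
    assume r: "r \<in> C \<and> (\<forall>y\<in>C. dist a r \<le> dist a y)"
    then have "(dist a r)\<^sup>2 \<le> D"
      using qC \<open>(dist a q)\<^sup>2 \<le> D\<close> power_mono[of "dist a r" "dist a q" 2]
      by (meson order_trans zero_le_dist)
    then have "(dist r q)\<^sup>2 \<le> 0"
      using gap[OF conjunct1[OF r] qC] \<open>(dist a q)\<^sup>2 \<le> D\<close> by argo
    then show "r = q"
      by simp
  qed
qed

lemma metric_projection:
  fixes C :: "'a::{real_inner, banach} set"
  assumes "convex C" "closed C" "C \<noteq> {}"
  shows metric_projection_in: "metric_projection C a \<in> C"
    and metric_projection_le: "y \<in> C \<Longrightarrow> dist a (metric_projection C a) \<le> dist a y"
  using theI'[OF ex1_nearest_point[OF assms, of a]] unfolding metric_projection_def by auto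

section \<open>Firmly nonexpansive maps and their averages\<close>

lemma norm_sum_power2_le:
  fixes a :: "'i \<Rightarrow> 'a::real_inner"
  assumes "\<And>i. i \<in> I \<Longrightarrow> 0 \<le> l i" "sum l I = 1"
  shows "(norm (\<Sum>i\<in>I. l i *\<^sub>R a i))\<^sup>2 \<le> (\<Sum>i\<in>I. l i * (norm (a i))\<^sup>2)"
proof -
  define b where "b = (\<Sum>i\<in>I. l i *\<^sub>R a i)"
  \<comment> \<open>The weighted variance about the mean \<open>b\<close> is nonnegative; expanding
    it gives the claim.\<close>
  have "0 \<le> (\<Sum>i\<in>I. l i * (norm (a i - b))\<^sup>2)"
    using assms(1) by (intro sum_nonneg) simp
  also have "\<dots> = (\<Sum>i\<in>I. l i * (norm (a i))\<^sup>2 - 2 * ((l i *\<^sub>R a i) \<bullet> b) + l i * (norm b)\<^sup>2)"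
    by (intro sum.cong refl)
      (simp add: power2_norm_eq_inner inner_diff_left inner_diff_right inner_commute algebra_simps)
  also have "\<dots> = (\<Sum>i\<in>I. l i * (norm (a i))\<^sup>2) - 2 * (b \<bullet> b) + sum l I * (norm b)\<^sup>2"
    unfolding b_def
    by (simp only: sum.distrib sum_subtractf inner_sum_left sum_distrib_left sum_distrib_right)
  finally show ?thesis
    using assms(2) by (simp add: b_def power2_norm_eq_inner)
qed

text \<open>Firm nonexpansiveness says that the increments of \<open>T\<close> and of Id -
  \<open>T\<close> have nonnegative inner product, a condition symmetric in the two maps.\<close>

lemma firmly_nonexpansive_complement:
  assumes "firmly_nonexpansive T"
  shows "firmly_nonexpansive (\<lambda>x. x - T x)"
  unfolding firmly_nonexpansive_def
proof (intro allI)
  fix x y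
  have "(norm (T x - T y))\<^sup>2 \<le> (x - y) \<bullet> (T x - T y)"
    using assms by (simp add: firmly_nonexpansive_def)
  moreover have "x - T x - (y - T y) = (x - y) - (T x - T y)"
    by simp
  ultimately show "(norm (x - T x - (y - T y)))\<^sup>2 \<le> (x - y) \<bullet> (x - T x - (y - T y))"
    by (simp only: power2_norm_eq_inner inner_diff_left[of "x - y" "T x - T y"]
        inner_diff_right[of _ "x - y" "T x - T y"])
      (simp add: inner_commute)
qed

lemma firmly_nonexpansive_dist_le:
  assumes "firmly_nonexpansive T"
  shows "dist (T x) (T y) \<le> dist x y"
proof -
  have "(norm (T x - T y))\<^sup>2 \<le> norm (x - y) * norm (T x - T y)"
    using assms norm_cauchy_schwarz order_trans unfolding firmly_nonexpansive_def by blast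
  then show ?thesis
    by (cases "T x = T y") (auto simp: dist_norm power2_eq_square)
qed

lemma firmly_nonexpansive_convex_combination:
  assumes "\<And>i. i \<in> I \<Longrightarrow> firmly_nonexpansive (F i)"
    and "\<And>i. i \<in> I \<Longrightarrow> 0 \<le> l i" "sum l I = 1"
  shows "firmly_nonexpansive (\<lambda>x. \<Sum>i\<in>I. l i *\<^sub>R F i x)"
  unfolding firmly_nonexpansive_def
proof (intro allI)
  fix x y
  have "(norm (\<Sum>i\<in>I. l i *\<^sub>R (F i x - F i y)))\<^sup>2 \<le> (\<Sum>i\<in>I. l i * (norm (F i x - F i y))\<^sup>2)"
    using assms(2,3) by (rule norm_sum_power2_le)
  also have "\<dots> \<le> (\<Sum>i\<in>I. l i * ((x - y) \<bullet> (F i x - F i y)))"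
    using assms(1,2) by (intro sum_mono mult_left_mono) (auto simp: firmly_nonexpansive_def)
  finally show "(norm ((\<Sum>i\<in>I. l i *\<^sub>R F i x) - (\<Sum>i\<in>I. l i *\<^sub>R F i y)))\<^sup>2
      \<le> (x - y) \<bullet> ((\<Sum>i\<in>I. l i *\<^sub>R F i x) - (\<Sum>i\<in>I. l i *\<^sub>R F i y))"
    by (simp add: inner_sum_right sum_subtractf[symmetric] scaleR_diff_right[symmetric])
qed

section \<open>Closed ranges of averages\<close>

lemma firmly_nonexpansive_regularized_solution:
  fixes F :: "'a::{real_inner, banach} \<Rightarrow> 'a"
  assumes "firmly_nonexpansive F" "e > 0"
  shows "\<exists>x. e *\<^sub>R x + F x = z"
proof -
  \<comment> \<open>Adding \<open>x - F x\<close> to both sides of the equation turns its solutions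
    into the fixed points of \<open>g\<close>. As Id - \<open>F\<close> is nonexpansive,
    \<open>g\<close> is a contraction.\<close>
  define g where "g x = inverse (1 + e) *\<^sub>R (z + (x - F x))" for x
  have "dist (g x) (g y) \<le> inverse (1 + e) * dist x y" for x y
  proof -
    have "dist (g x) (g y) = inverse (1 + e) * dist (x - F x) (y - F y)"
      unfolding g_def dist_norm scaleR_diff_right[symmetric] using assms(2) by simp
    then show ?thesis
      using assms firmly_nonexpansive_dist_le[OF firmly_nonexpansive_complement, of F x y]
      by (simp add: mult_left_mono)
  qed
  then have "\<exists>!x. g x = x"
    using assms(2) by (intro banach_fix_type[of "inverse (1 + e)"]) (auto simp: field_simps)
  then obtain x where "g x = x"
    by auto
  then have "(1 + e) *\<^sub>R x = z + (x - F x)"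
    using assms(2) unfolding g_def by (metis add_pos_pos less_irrefl scaleR_one
        right_inverse scaleR_scaleR zero_less_one)
  then have "e *\<^sub>R x + F x = z"
    by (simp add: algebra_simps)
  then show ?thesis ..
qed

lemma sum_in_closure_range:
  fixes F :: "'i \<Rightarrow> 'a::{real_inner, banach} \<Rightarrow> 'a"
  assumes firm: "\<And>i. i \<in> I \<Longrightarrow> firmly_nonexpansive (F i)"
    and l: "\<And>i. i \<in> I \<Longrightarrow> 0 \<le> l i" "sum l I = 1"
  shows "(\<Sum>i\<in>I. l i *\<^sub>R F i (y i)) \<in> closure (range (\<lambda>x. \<Sum>i\<in>I. l i *\<^sub>R F i x))"
    (is "?z \<in> closure (range ?F)")
  unfolding closure_approachable
proof (intro allI impI)
  fix d :: real
  assume "d > 0"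
  define C where "C = (\<Sum>i\<in>I. l i * ((norm (y i))\<^sup>2 / 4))"
  have "C \<ge> 0"
    unfolding C_def using l(1) by (intro sum_nonneg) simp
  \<comment> \<open>Chosen so that \<open>e * C < d\<^sup>2\<close>; the added 1 covers the case
    \<open>C = 0\<close>.\<close>
  define e where "e = d\<^sup>2 / (C + 1)"
  have "e > 0"
    using \<open>d > 0\<close> \<open>C \<ge> 0\<close> by (simp add: e_def)
  obtain x where x: "e *\<^sub>R x + ?F x = ?z"
    using firmly_nonexpansive_regularized_solution[OF
        firmly_nonexpansive_convex_combination[of I F l, OF firm l] \<open>e > 0\<close>] by blast
  \<comment> \<open>With \<open>w\<close> the increment of \<open>F i\<close>, cocoercivity gives
    \<open>x \<bullet> w\<close> \<ge> \<open>w \<bullet> w + y i \<bullet> w\<close>. Completing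
    the square bounds this below independently of \<open>x\<close> and \<open>e\<close>.\<close>
  have "- ((norm (y i))\<^sup>2 / 4) \<le> x \<bullet> (F i x - F i (y i))" if "i \<in> I" for i
  proof -
    define w where "w = F i x - F i (y i)"
    have "w \<bullet> w \<le> (x - y i) \<bullet> w"
      using firm[OF that] by (simp add: firmly_nonexpansive_def w_def power2_norm_eq_inner)
    moreover have "0 \<le> (w + (1/2) *\<^sub>R y i) \<bullet> (w + (1/2) *\<^sub>R y i)"
      by simp
    ultimately show ?thesis
      unfolding w_def[symmetric] power2_norm_eq_inner
      by (simp add: inner_add_left inner_add_right inner_diff_left inner_diff_right inner_commute)
  qed
  then have "(\<Sum>i\<in>I. l i * - ((norm (y i))\<^sup>2 / 4)) \<le> (\<Sum>i\<in>I. l i * (x \<bullet> (F i x - F i (y i))))"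
    using l(1) by (intro sum_mono mult_left_mono)
  also have "\<dots> = x \<bullet> (?F x - ?z)"
    by (simp add: inner_sum_right sum_subtractf[symmetric] scaleR_diff_right[symmetric])
  \<comment> \<open>By the regularized equation the averaged inner product is minus
    \<open>e * (norm x)\<^sup>2\<close>, so the lower bound \<open>- C\<close> becomes an upper
    bound on this quantity.\<close>
  also have "?F x - ?z = - (e *\<^sub>R x)"
    using x by (simp add: algebra_simps)
  finally have "e * (norm x)\<^sup>2 \<le> C"
    by (simp add: C_def sum_negf power2_norm_eq_inner)
  then have "e * (e * (norm x)\<^sup>2) \<le> e * C"
    using \<open>e > 0\<close> by (intro mult_left_mono) auto
  also have "\<dots> < d\<^sup>2"
    using \<open>d > 0\<close> \<open>C \<ge> 0\<close> by (simp add: e_def field_simps)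
  finally have "(e * norm x)\<^sup>2 < d\<^sup>2"
    by (simp add: power2_eq_square mult_ac)
  then have "e * norm x < d"
    using \<open>d > 0\<close> by (simp add: power_less_imp_less_base)
  moreover have "dist (?F x) ?z = e * norm x"
    using \<open>e > 0\<close> by (simp add: dist_norm x[symmetric])
  ultimately have "dist (?F x) ?z < d"
    by simp
  then show "\<exists>u\<in>range ?F. dist u ?z < d"
    by blast
qed

text \<open>A convex combination of values of \<open>F\<close> is a sum as in
  \<open>sum_in_closure_range\<close> with every map equal to \<open>F\<close>, and then the
  averaged map is \<open>F\<close> itself. So the convex hull of the range has the same closure as
  the range.\<close>

lemma convex_closure_range_firmly_nonexpansive:
  fixes F :: "'a::{real_inner, banach} \<Rightarrow> 'a"
  assumes "firmly_nonexpansive F"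
  shows "convex (closure (range F))"
proof -
  have "convex hull range F \<subseteq> closure (range F)"
  proof
    fix z
    assume "z \<in> convex hull range F"
    then obtain k :: nat and u y where u: "\<And>i. i \<in> {1..k} \<Longrightarrow> 0 \<le> u i" "sum u {1..k} = 1"
      and y: "\<And>i. i \<in> {1..k} \<Longrightarrow> y i \<in> range F" and z: "z = (\<Sum>i=1..k. u i *\<^sub>R y i)"
      unfolding convex_hull_indexed by blast
    from y have "\<forall>i. \<exists>x. i \<in> {1..k} \<longrightarrow> y i = F x"
      by blast
    then obtain x where x: "\<And>i. i \<in> {1..k} \<Longrightarrow> y i = F (x i)"
      by metis
    have "(\<Sum>i=1..k. u i *\<^sub>R F (x i)) \<in> closure (range (\<lambda>x. \<Sum>i=1..k. u i *\<^sub>R F x))"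
      using assms u by (intro sum_in_closure_range[where F = "\<lambda>_. F"])
    moreover have z_eq: "z = (\<Sum>i=1..k. u i *\<^sub>R F (x i))"
      unfolding z using x by (intro sum.cong) simp_all
    moreover have "(\<Sum>i=1..k. u i *\<^sub>R F x) = F x" for x
      using u(2) by (simp add: scaleR_sum_left[symmetric])
    ultimately show "z \<in> closure (range F)"
      by (simp only: z_eq)
  qed
  then have "closure (range F) = closure (convex hull range F)"
    by (intro antisym closure_mono hull_subset closure_minimal) auto
  then show ?thesis
    by (simp add: convex_closure)
qed

section \<open>Minimal displacement vectors\<close>

lemma min_displacement:
  fixes S :: "'a::{real_inner, banach} \<Rightarrow> 'a"
  assumes "firmly_nonexpansive S"
  shows min_displacement_in: "min_displacement S \<in> closure (range (\<lambda>x. x - S x))"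
    and norm_min_displacement_le:
      "u \<in> closure (range (\<lambda>x. x - S x)) \<Longrightarrow> norm (min_displacement S) \<le> norm u"
proof -
  \<comment> \<open>Convexity ensures that the definite description in
    \<open>metric_projection\<close> denotes a nearest point.\<close>
  note C = convex_closure_range_firmly_nonexpansive[OF firmly_nonexpansive_complement[OF assms]]
  show "min_displacement S \<in> closure (range (\<lambda>x. x - S x))"
    unfolding min_displacement_def using C by (intro metric_projection_in) auto
  show "norm (min_displacement S) \<le> norm u" if "u \<in> closure (range (\<lambda>x. x - S x))"
    using metric_projection_le[OF C _ _ that, of 0] by (simp add: min_displacement_def)
qed

theorem theorem3p2:
  fixes T :: "nat \<Rightarrow> 'a::{real_inner, banach} \<Rightarrow> 'a"
    and l :: "nat \<Rightarrow> real"
    and m :: nat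
  assumes "m \<ge> 2"
    and "\<And>i. i \<in> {1..m} \<Longrightarrow> firmly_nonexpansive (T i)"
    and "\<And>i. i \<in> {1..m} \<Longrightarrow> l i \<in> {0<..1}"
    and "(\<Sum>i=1..m. l i) = 1"
  shows "norm (min_displacement (\<lambda>x. \<Sum>i=1..m. l i *\<^sub>R T i x))
           \<le> norm (\<Sum>i=1..m. l i *\<^sub>R min_displacement (T i))"
proof -
  let ?T = "\<lambda>x. \<Sum>i=1..m. l i *\<^sub>R T i x"
  have l: "0 \<le> l i" if "i \<in> {1..m}" for i
    using assms(3)[OF that] by simp
  have eq: "(\<Sum>i=1..m. l i *\<^sub>R (x - T i x)) = x - ?T x" for x
    using assms(4) by (simp add: scaleR_diff_right sum_subtractf scaleR_sum_left[symmetric])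
  \<comment> \<open>The minimal displacement need not be attained, so it is approximated by actual
    displacements. The membership stands inside the existential so that one choice serves all
    indices.\<close>
  have "\<forall>i. \<exists>y. i \<in> {1..m} \<longrightarrow> (\<lambda>n. y n - T i (y n)) \<longlonglongrightarrow> min_displacement (T i)"
  proof
    fix i
    show "\<exists>y. i \<in> {1..m} \<longrightarrow> (\<lambda>n. y n - T i (y n)) \<longlonglongrightarrow> min_displacement (T i)"
    proof (cases "i \<in> {1..m}")
      case True
      obtain f where f: "\<And>n. f n \<in> range (\<lambda>x. x - T i x)" "f \<longlonglongrightarrow> min_displacement (T i)"
        using min_displacement_in[OF assms(2)[OF True]] unfolding closure_sequential by blast
      from f(1) obtain y where "\<And>n. f n = y n - T i (y n)"
        unfolding image_iff by metis
      then have "f = (\<lambda>n. y n - T i (y n))"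
        by blast
      then show ?thesis
        using f(2) by blast
    qed blast
  qed
  then obtain y where
    y: "\<And>i. i \<in> {1..m} \<Longrightarrow> (\<lambda>n. y i n - T i (y i n)) \<longlonglongrightarrow> min_displacement (T i)"
    by metis
  \<comment> \<open>For each \<open>n\<close> the averaged displacements at the points
    \<open>y i n\<close> lie in this closed set, hence so does their limit.\<close>
  have "(\<Sum>i=1..m. l i *\<^sub>R min_displacement (T i)) \<in> closure (range (\<lambda>x. x - ?T x))"
  proof (rule closed_sequentially[OF closed_closure])
    show "(\<lambda>n. \<Sum>i=1..m. l i *\<^sub>R (y i n - T i (y i n)))
        \<longlonglongrightarrow> (\<Sum>i=1..m. l i *\<^sub>R min_displacement (T i))"
      by (intro tendsto_sum tendsto_scaleR tendsto_const y)
    fix n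
    show "(\<Sum>i=1..m. l i *\<^sub>R (y i n - T i (y i n))) \<in> closure (range (\<lambda>x. x - ?T x))"
      using sum_in_closure_range[of "{1..m}" "\<lambda>i x. x - T i x" l "\<lambda>i. y i n"]
        firmly_nonexpansive_complement assms(2,4) l
      unfolding eq by blast
  qed
  then show ?thesis
    using firmly_nonexpansive_convex_combination[OF assms(2) l assms(4)]
    by (intro norm_min_displacement_le)
qed

end
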